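(* Let $b$ be a normalizing function with index $\alpha=2$, and let $X_1,X_2\in\mathbb{V}_b\setminus\mathcal{N}_b$ be random variables on a probability space $(\Omega,\Sigma,\mathbb{P})$. Suppose that $X_1,X_2$ are jointly regularly varying with normalizing function $b$, with exponent measure $\nu_{\boldsymbol{X}}$ and angular measure $H_{\boldsymbol{X}}$ under the (Euclidean) polar transformation. Then $\|\cdot\|_b$ satisfies the parallelogram law for $X_1,X_2$: $$\|X_1+X_2\|_b^2+\|X_1-X_2\|_b^2=2\|X_1\|_b^2+2\|X_2\|_b^2.$$
   Context: A measurable function $L:(0,\infty)\to(0,\infty)$ is slowly varying if $\lim_{s\to\infty} L(sx)/L(s)=1$ for all $x>0$. A normalizing function with index $\alpha>0$ is a function $b(s)=s^{\alpha}L(s)$ with $L$ slowly varying. $\mathbb{V}_b$ is the set of real-valued random variables $X$ on $(\Omega,\Sigma,\mathbb{P})$ such that for every $x>0$ the limits $\lim_{s\to\infty} b(s)\mathbb{P}(X>sx)$ and $\lim_{s\to\infty} b(s)\mathbb{P}(X<-sx)$ exist and are finite; $\mathcal{N}_b$ is the set of $X\in\mathbb{V}_b$ for which all these limits are $0$. For $X\in\mathbb{V}_b$, $\|X\|_b=\{\lim_{s\to\infty} b(s)\mathbb{P}(|X|>s)\}^{1/\alpha}$. A random vector $\boldsymbol{X}$ in $\mathbb{R}^d$ is (jointly) regularly varying with normalizing function $b$ if $b(s)\mathbb{P}(s^{-1}\boldsymbol{X}\in\cdot)$ converges vaguely as $s\to\infty$ to a nonzero Radon measure $\nu_{\boldsymbol{X}}$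 on the Borel sets of $[-\infty,\infty]^d\setminus\{\boldsymbol{0}\}$, where $\nu_{\boldsymbol{X}}$ (the exponent measure) puts no mass on $[-\infty,\infty]^d\setminus(-\infty,\infty)^d$. The angular measure $H_{\boldsymbol{X}}$ is the finite Borel measure on the unit sphere $\mathbb{S}^{d-1}$ determined by $\nu_{\boldsymbol{X}}(\{x:\|x\|>r,\ x/\|x\|\in B\})=r^{-\alpha}H_{\boldsymbol{X}}(B)$ for $r>0$ and Borel $B\subset\mathbb{S}^{d-1}$. Here $d=2$ and the norm is Euclidean: $R=\sqrt{X_1^2+X_2^2}$, $\boldsymbol{\omega}=(X_1/R,X_2/R)$. *)

theory Defs
  imports "HOL-Probability.Probability"
begin

definition slowly_varying :: "(real \<Rightarrow> real) \<Rightarrow> bool" where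
  "slowly_varying L \<longleftrightarrow>
     L \<in> borel_measurable (restrict_space borel {0<..}) \<and> (\<forall>s>0. L s > 0) \<and>
     (\<forall>x>0. ((\<lambda>s. L (s * x) / L s) \<longlongrightarrow> 1) at_top)"

text \<open>Functions on the half-line \<open>(0,\<infinity>)\<close> are rendered as functions on all reals;
  their values at nonpositive arguments are irrelevant.\<close>

definition normalizing_function :: "real \<Rightarrow> (real \<Rightarrow> real) \<Rightarrow> bool" where
  "normalizing_function \<alpha> b \<longleftrightarrow>
     \<alpha> > 0 \<and> (\<exists>L. slowly_varying L \<and> (\<forall>s>0. b s = s powr \<alpha> * L s))"

definition V_set :: "'o measure \<Rightarrow> (real \<Rightarrow> real) \<Rightarrow> ('o \<Rightarrow> real) set" where
  "V_set M b = {X \<in> borel_measurable M. \<forall>x>0.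
     (\<exists>l::real. ((\<lambda>s. b s * measure M {\<omega> \<in> space M. X \<omega> > s * x}) \<longlongrightarrow> l) at_top) \<and>
     (\<exists>l::real. ((\<lambda>s. b s * measure M {\<omega> \<in> space M. X \<omega> < - (s * x)}) \<longlongrightarrow> l) at_top)}"

definition N_set :: "'o measure \<Rightarrow> (real \<Rightarrow> real) \<Rightarrow> ('o \<Rightarrow> real) set" where
  "N_set M b = {X \<in> V_set M b. \<forall>x>0.
     ((\<lambda>s. b s * measure M {\<omega> \<in> space M. X \<omega> > s * x}) \<longlongrightarrow> 0) at_top \<and>
     ((\<lambda>s. b s * measure M {\<omega> \<in> space M. X \<omega> < - (s * x)}) \<longlongrightarrow> 0) at_top}"

text \<open>Meaningful only for \<open>X \<in> V_set M b\<close>, where the limit exists; \<open>\<alpha>\<close> is the index of \<open>b\<close>.\<close>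

definition norm_b :: "'o measure \<Rightarrow> (real \<Rightarrow> real) \<Rightarrow> real \<Rightarrow> ('o \<Rightarrow> real) \<Rightarrow> real" where
  "norm_b M b \<alpha> X =
     (Lim at_top (\<lambda>s. b s * measure M {\<omega> \<in> space M. \<bar>X \<omega>\<bar> > s})) powr (1 / \<alpha>)"

text \<open>For the space \<open>E\<close> used below (locally compact with countable base) every Borel measure
  that is finite on compact sets is automatically regular, so this is the usual notion of a
  Radon measure.\<close>

definition radon_measure_on :: "'a::topological_space set \<Rightarrow> 'a measure \<Rightarrow> bool" where
  "radon_measure_on E \<nu> \<longleftrightarrow>
     sets \<nu> = sets (restrict_space borel E) \<and>
     (\<forall>K. compact K \<and> K \<subseteq> E \<longrightarrow> emeasure \<nu> K < \<infinity>)"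

definition vague_tendsto ::
    "'a::topological_space set \<Rightarrow> ('i \<Rightarrow> 'a measure) \<Rightarrow> 'a measure \<Rightarrow> 'i filter \<Rightarrow> bool" where
  "vague_tendsto E \<mu> \<nu> F \<longleftrightarrow>
     (\<forall>f :: 'a \<Rightarrow> real. continuous_on E f \<and>
        (\<exists>K. compact K \<and> K \<subseteq> E \<and> (\<forall>x\<in>E - K. f x = 0)) \<longrightarrow>
        ((\<lambda>s. integral\<^sup>L (\<mu> s) f) \<longlongrightarrow> integral\<^sup>L \<nu> f) F)"

text \<open>The extended plane \<open>[-\<infinity>,\<infinity>]\<^sup>2\<close> without the origin: its compact
  subsets are the closed sets bounded away from the origin.\<close>

definition punctured_plane :: "(ereal \<times> ereal) set" where
  "punctured_plane = UNIV - {(0, 0)}"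

definition embed_plane :: "real \<times> real \<Rightarrow> ereal \<times> ereal" where
  "embed_plane = map_prod ereal ereal"

text \<open>The measure \<open>b(s) P(X / s \<in> \<cdot>)\<close> on the Borel sets of the punctured plane.\<close>

definition scaled_law ::
    "'o measure \<Rightarrow> (real \<Rightarrow> real) \<Rightarrow> ('o \<Rightarrow> real \<times> real) \<Rightarrow> real \<Rightarrow> (ereal \<times> ereal) measure" where
  "scaled_law M b X s =
     scale_measure (ennreal (b s))
       (restrict_space (distr M borel (\<lambda>\<omega>. embed_plane (X \<omega> /\<^sub>R s))) punctured_plane)"

definition regularly_varying_with ::
    "'o measure \<Rightarrow> (real \<Rightarrow> real) \<Rightarrow> ('o \<Rightarrow> real \<times> real) \<Rightarrow> (ereal \<times> ereal) measure \<Rightarrow> bool" where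
  "regularly_varying_with M b X \<nu> \<longleftrightarrow>
     X \<in> borel_measurable M \<and>
     radon_measure_on punctured_plane \<nu> \<and>
     emeasure \<nu> punctured_plane \<noteq> 0 \<and>
     emeasure \<nu> (punctured_plane - range embed_plane) = 0 \<and>
     vague_tendsto punctured_plane (scaled_law M b X) \<nu> at_top"

text \<open>The norm on \<^typ>\<open>real \<times> real\<close> is the Euclidean one.  Points with an infinite
  coordinate carry no mass of an exponent measure, so the polar sets are taken among the
  finite points.\<close>

definition angular_measure_of ::
    "real \<Rightarrow> (ereal \<times> ereal) measure \<Rightarrow> (real \<times> real) measure \<Rightarrow> bool" where
  "angular_measure_of \<alpha> \<nu> H \<longleftrightarrow>
     sets H = sets (restrict_space borel (sphere 0 1)) \<and> finite_measure H \<and>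
     (\<forall>r>0. \<forall>B\<in>sets H.
        emeasure \<nu> (embed_plane ` {x. norm x > r \<and> x /\<^sub>R norm x \<in> B}) =
        ennreal (r powr (- \<alpha>)) * emeasure H B)"

end

theory Submission
  imports Defs "HOL-Real_Asymp.Real_Asymp"
begin

text \<open>For a continuous positively homogeneous \<open>u\<close>, the limit of \<open>b(s) P(u(X) > s)\<close> is the exponent
  measure of \<open>{u > 1}\<close>, which the polar decomposition evaluates as the integral of
  \<open>(u\<^sup>+)\<^sup>\<alpha>\<close> against the angular measure.  With \<open>\<alpha> = 2\<close> and \<open>u = \<bar>l\<bar>\<close> for a linear \<open>l\<close>,
  the squared tail norm of \<open>l(X)\<close> is therefore the integral of \<open>l\<^sup>2\<close>, and the
  parallelogram law holds pointwise on the circle.\<close>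

text \<open>Membership of X1 and X2 in \<open>V_set\<close> gives no limits for X1 + X2 and X1 - X2.
  Joint regular variation must supply them, but vague convergence tests only functions that vanish
  near the origin, on a space with points at infinity. It is therefore used only for functions
  supported in an annulus of the finite plane, and what lies beyond a large radius is bounded
  through the marginal tails: by slow variation, b(s) P(|X| > s t) is eventually in s at most C
  t^(-\<alpha>), with C independent of t. Pushing the exponent measure forward to the real plane
  removes the extended reals from the polar argument, which then works in any Euclidean space.
  Positive homogeneity is the right generality for u: the one-sided tails in \<open>V_set\<close>
  come from u/x and -u/x, the norm comes from |u|, and all are instances of one limit
  theorem.\<close>

section \<open>Homogeneous functions under a polar decomposition\<close>

locale polar_measure = H: finite_measure H
  for N :: "'a::euclidean_space measure" and H :: "'a measure" and \<alpha> :: real +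
  assumes sets_N [measurable_cong]: "sets N = sets borel"
    and sets_H [measurable_cong]: "sets H = sets (restrict_space borel (sphere 0 1))"
    and alpha_pos: "\<alpha> > 0"
    and polar: "\<And>r B. r > 0 \<Longrightarrow> B \<in> sets H \<Longrightarrow>
      emeasure N {x. norm x > r \<and> x /\<^sub>R norm x \<in> B} = ennreal (r powr (- \<alpha>)) * emeasure H B"
begin

lemma space_N: "space N = UNIV"
  using sets_eq_imp_space_eq[OF sets_N] by simp

lemma space_H: "space H = sphere 0 1"
  using sets_eq_imp_space_eq[OF sets_H] by (simp add: space_restrict_space)

lemma borel_measurable_H: "f \<in> borel_measurable borel \<Longrightarrow> f \<in> borel_measurable H"
  unfolding measurable_cong_sets[OF sets_H refl] by (rule measurable_restrict_space1)

lemma sets_H_iff: "B \<in> sets H \<longleftrightarrow> B \<in> sets borel \<and> B \<subseteq> sphere 0 1"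
  unfolding sets_H by (subst sets_restrict_space_iff) auto

text \<open>For c > 0 the condition says that the norm exceeds r = c^(-1/\<alpha>), and the polar
  identity then contributes the factor r^(-\<alpha>) = c. Being linear in c, the value can be summed
  over the values of a simple function.\<close>

lemma emeasure_polar_level:
  assumes B: "B \<in> sets H" and c: "c < top"
  shows "emeasure N {x. x /\<^sub>R norm x \<in> B \<and> c * ennreal (norm x powr \<alpha>) > 1} = c * emeasure H B"
proof (cases "c = 0")
  case True
  then show ?thesis by simp
next
  case False
  then obtain d where d: "d > 0" "c = ennreal d"
    using c by (cases c) (auto simp: less_le)
  define r where "r = d powr (- (1 / \<alpha>))"
  have r: "r > 0" "r powr (- \<alpha>) = d"
    using d alpha_pos by (auto simp: r_def powr_powr)
  have "c * ennreal (norm x powr \<alpha>) > 1 \<longleftrightarrow> norm x > r" for x :: 'a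
  proof -
    have "c * ennreal (norm x powr \<alpha>) > 1 \<longleftrightarrow> d * norm x powr \<alpha> > 1"
      using d ennreal_less_iff[of 1 "d * norm x powr \<alpha>"]
      by (simp add: ennreal_mult[symmetric] flip: ennreal_1)
    also have "\<dots> \<longleftrightarrow> norm x powr \<alpha> > r powr \<alpha>"
    proof -
      have "r powr \<alpha> = inverse d" using r d by (metis inverse_inverse_eq powr_minus)
      then show ?thesis using d by (simp add: pos_divide_less_eq mult.commute inverse_eq_divide)
    qed
    also have "\<dots> \<longleftrightarrow> norm x > r"
      using r alpha_pos by (meson less_eq_real_def norm_ge_zero not_less powr_less_mono2 powr_mono2)
    finally show ?thesis .
  qed
  then have "{x. x /\<^sub>R norm x \<in> B \<and> c * ennreal (norm x powr \<alpha>) > 1}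
      = {x. norm x > r \<and> x /\<^sub>R norm x \<in> B}"
    by auto
  then show ?thesis using polar[OF r(1) B] d r by simp
qed

text \<open>Sorting points by the value of f at their direction splits the set into finitely many
  disjoint sets of the form just measured; their sum is the simple integral of f.\<close>

lemma emeasure_polar_simple:
  assumes f: "simple_function H f" and fin: "\<And>x. f x < top"
  shows "{x. x \<noteq> 0 \<and> f (x /\<^sub>R norm x) * ennreal (norm x powr \<alpha>) > 1} \<in> sets borel" (is "?S \<in> _")
    and "emeasure N {x. x \<noteq> 0 \<and> f (x /\<^sub>R norm x) * ennreal (norm x powr \<alpha>) > 1} = integral\<^sup>N H f"
proof -
  define B where "B c = f -` {c} \<inter> space H" for c
  define A where "A c = {x. x /\<^sub>R norm x \<in> B c \<and> c * ennreal (norm x powr \<alpha>) > 1}" for c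
  have B: "B c \<in> sets H" for c
    using f by (simp add: B_def simple_functionD(2))
  have Bb[measurable]: "B c \<in> sets borel" for c
    using B by (simp add: sets_H_iff)
  have A: "A c \<in> sets borel" for c
    unfolding A_def by measurable
  have fin_range: "finite (f ` space H)"
    using f by (rule simple_functionD)
  have S: "?S = (\<Union>c\<in>f ` space H. A c)"
    by (auto simp: A_def B_def space_H image_iff intro!: bexI[of _ "_ /\<^sub>R norm _"])
  show "?S \<in> sets borel"
    unfolding S using A fin_range by (intro sets.finite_UN) auto
  have "emeasure N ?S = (\<Sum>c\<in>f ` space H. emeasure N (A c))"
    unfolding S using A fin_range
    by (intro sum_emeasure[symmetric]) (auto simp: sets_N disjoint_family_on_def A_def B_def)
  also have "\<dots> = (\<Sum>c\<in>f ` space H. c * emeasure H (B c))"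
    unfolding A_def using fin B by (intro sum.cong refl emeasure_polar_level) auto
  also have "\<dots> = integral\<^sup>N H f"
    using f by (simp add: nn_integral_eq_simple_integral simple_integral_def B_def)
  finally show "emeasure N ?S = integral\<^sup>N H f" .
qed

text \<open>Simple functions increasing to \<open>(u\<^sup>+)\<^sup>\<alpha>\<close> turn the polar decomposition into an
  integral over the sphere without a product measure; the strict inequality makes the
  corresponding sets increase to \<open>{u > 1}\<close>.\<close>

lemma emeasure_homogeneous:
  fixes u :: "'a \<Rightarrow> real"
  assumes u: "u \<in> borel_measurable borel" and hom: "\<And>t x. t > 0 \<Longrightarrow> u (t *\<^sub>R x) = t * u x"
  shows "emeasure N {x. u x > 1} = (\<integral>\<^sup>+ w. ennreal (max 0 (u w) powr \<alpha>) \<partial>H)"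
proof -
  define v where "v w = ennreal (max 0 (u w) powr \<alpha>)" for w
  have "v \<in> borel_measurable H"
    unfolding v_def using u by (intro borel_measurable_H) measurable
  from borel_measurable_implies_simple_function_sequence'[OF this]
  obtain f where f: "\<And>i. simple_function H (f i)" "incseq f" "\<And>i x. f i x < top"
      "\<And>x. (SUP i. f i x) = v x"
    by blast
  define S where "S i = {x. x \<noteq> 0 \<and> f i (x /\<^sub>R norm x) * ennreal (norm x powr \<alpha>) > 1}" for i
  have u0: "u 0 = 0" using hom[of 2 0] by simp
  have "u x > 1 \<longleftrightarrow> (\<exists>i. x \<in> S i)" for x
  proof (cases "x = 0")
    case False
    have "(\<exists>i. x \<in> S i) \<longleftrightarrow> (SUP i. f i (x /\<^sub>R norm x) * ennreal (norm x powr \<alpha>)) > 1"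
      using False by (simp add: S_def less_SUP_iff)
    also have "(SUP i. f i (x /\<^sub>R norm x) * ennreal (norm x powr \<alpha>))
        = v (x /\<^sub>R norm x) * ennreal (norm x powr \<alpha>)"
      by (simp add: SUP_mult_right_ennreal f(4)[symmetric])
    \<comment> \<open>Both factors are \<alpha>-th powers, so they merge, and homogeneity absorbs
      the norm into the argument of u.\<close>
    also have "\<dots> = ennreal ((max 0 (u (x /\<^sub>R norm x)) * norm x) powr \<alpha>)"
      by (simp add: v_def powr_mult ennreal_mult)
    also have "max 0 (u (x /\<^sub>R norm x)) * norm x = max 0 (u x)"
      using False by (simp add: hom max_def field_simps mult_le_0_iff zero_le_mult_iff)
    also have "ennreal (max 0 (u x) powr \<alpha>) > 1 \<longleftrightarrow> max 0 (u x) powr \<alpha> > 1 powr \<alpha>"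
      using ennreal_less_iff[of 1 "max 0 (u x) powr \<alpha>"] by simp
    also have "\<dots> \<longleftrightarrow> u x > 1"
      using alpha_pos powr_less_mono2[of \<alpha> 1 "max 0 (u x)"] powr_mono2[of \<alpha> "max 0 (u x)" 1]
      by (cases "u x > 1") (auto simp: not_less)
    finally show ?thesis by simp
  qed (simp add: u0 S_def)
  then have "{x. u x > 1} = (\<Union>i. S i)" by auto
  moreover have "incseq S"
  proof (rule monoI)
    fix i j :: nat assume "i \<le> j"
    then have "f i w \<le> f j w" for w using f(2) by (auto simp: incseq_def le_fun_def)
    then show "S i \<le> S j"
      unfolding S_def by (auto intro!: mult_right_mono elim!: less_le_trans)
  qed
  moreover have "range S \<subseteq> sets N"
    using emeasure_polar_simple(1)[OF f(1,3)] by (auto simp: S_def sets_N)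
  ultimately have "emeasure N {x. u x > 1} = (SUP i. emeasure N (S i))"
    by (simp add: SUP_emeasure_incseq)
  also have "\<dots> = (SUP i. integral\<^sup>N H (f i))"
    unfolding S_def by (simp add: emeasure_polar_simple(2)[OF f(1,3)])
  also have "\<dots> = (\<integral>\<^sup>+ w. (SUP i. f i w) \<partial>H)"
    using f(1,2) by (intro nn_integral_monotone_convergence_SUP[symmetric])
      (auto intro: borel_measurable_simple_function)
  finally show ?thesis by (simp add: f(4) v_def)
qed

text \<open>The real-valued form of the measure of {u > 1}. The positive part is taken because u may
  change sign and only its upper tail is measured.\<close>

definition radial_moment :: "('a \<Rightarrow> real) \<Rightarrow> real" where
  "radial_moment u = (\<integral>w. max 0 (u w) powr \<alpha> \<partial>H)"

lemma integrable_radial: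
  assumes "continuous_on UNIV u"
  shows "integrable H (\<lambda>w. max 0 (u w) powr \<alpha>)"
proof -
  have "compact ((\<lambda>w. max 0 (u w) powr \<alpha>) ` sphere 0 1)"
    using alpha_pos continuous_on_subset[OF assms subset_UNIV]
    by (intro compact_continuous_image continuous_on_powr' continuous_intros) auto
  then have "bounded ((\<lambda>w. max 0 (u w) powr \<alpha>) ` sphere 0 1)"
    by (rule compact_imp_bounded)
  then obtain C where C: "\<And>w. w \<in> sphere 0 1 \<Longrightarrow> \<bar>max 0 (u w) powr \<alpha>\<bar> \<le> C"
    unfolding bounded_iff by (metis imageI real_norm_def)
  have [measurable]: "u \<in> borel_measurable borel"
    using assms by (rule borel_measurable_continuous_onI)
  have "(\<lambda>w. max 0 (u w) powr \<alpha>) \<in> borel_measurable H"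
    by (intro borel_measurable_H) measurable
  then show ?thesis
    using C by (intro H.integrable_const_bound[of _ C]) (auto simp: space_H)
qed

lemma emeasure_homogeneous_level:
  assumes u: "continuous_on UNIV u" and hom: "\<And>t x. t > 0 \<Longrightarrow> u (t *\<^sub>R x) = t * u x" and c: "c > 0"
  shows "emeasure N {x. u x > c} = ennreal (c powr (- \<alpha>) * radial_moment u)"
proof -
  have [measurable]: "u \<in> borel_measurable borel"
    using u by (rule borel_measurable_continuous_onI)
  have "{x. u x > c} = {x. u x / c > 1}" using c by simp
  also have "emeasure N \<dots> = (\<integral>\<^sup>+ w. ennreal (max 0 (u w / c) powr \<alpha>) \<partial>H)"
    using hom by (intro emeasure_homogeneous) auto
  also have "\<dots> = (\<integral>\<^sup>+ w. ennreal (c powr (- \<alpha>) * max 0 (u w) powr \<alpha>) \<partial>H)"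
  proof (intro nn_integral_cong arg_cong[where f=ennreal])
    fix w
    have "max 0 (u w / c) = max 0 (u w) / c" using c by (simp add: max_def field_simps)
    then show "max 0 (u w / c) powr \<alpha> = c powr (- \<alpha>) * max 0 (u w) powr \<alpha>"
      unfolding \<open>max 0 (u w / c) = _\<close> using c by (simp add: powr_divide powr_minus inverse_eq_divide)
  qed
  also have "\<dots> = ennreal (\<integral>w. c powr (- \<alpha>) * max 0 (u w) powr \<alpha> \<partial>H)"
    using integrable_radial[OF u] by (intro nn_integral_eq_integral) auto
  finally show ?thesis by (simp add: radial_moment_def)
qed

section \<open>Test functions and tail limits\<close>

text \<open>A continuous substitute for the indicator of {u > 1}, supported in an annulus. The
  thresholds p < q stay free because p = 1 yields a minorant of the indicator, while q = 1 yields a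
  majorant up to the radius R.\<close>

lemma radial_test_function:
  fixes u :: "'a \<Rightarrow> real"
  assumes u: "continuous_on UNIV u" and hom: "\<And>t x. t > 0 \<Longrightarrow> u (t *\<^sub>R x) = t * u x"
    and p: "0 < p" "p < q" and R: "R > 0"
  obtains g :: "'a \<Rightarrow> real" where "continuous_on UNIV g"
    "\<exists>\<delta>>0. \<exists>K. \<forall>x::'a. norm x < \<delta> \<or> norm x > K \<longrightarrow> g x = 0"
    "\<And>x. 0 \<le> g x" "\<And>x. g x \<le> indicator {x. u x > p} x"
    "\<And>x. indicator {x. u x \<ge> q \<and> norm x \<le> R} x \<le> g x"
    "q powr (- \<alpha>) * radial_moment u - R powr (- \<alpha>) * radial_moment norm \<le> integral\<^sup>L N g"
    "integral\<^sup>L N g \<le> p powr (- \<alpha>) * radial_moment u"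
proof -
  \<comment> \<open>A ramp rising from 0 at u = p to 1 at u = q, times a radial cutoff falling from
    1 at radius R to 0 at R + 1.\<close>
  define g where "g x = max 0 (min 1 ((u x - p) / (q - p))) * max 0 (min 1 (R + 1 - norm x))" for x
  have cont: "continuous_on UNIV g"
    unfolding g_def using p by (intro continuous_intros u) auto
  have nonneg: "0 \<le> g x" for x by (simp add: g_def)
  have upper: "g x \<le> indicator {x. u x > p} x" for x
  proof (cases "u x > p")
    case False
    then have "(u x - p) / (q - p) \<le> 0" using p by (simp add: divide_le_0_iff)
    then show ?thesis by (simp add: g_def max_def)
  qed (auto simp: g_def intro!: mult_le_one)
  have lower: "indicator {x. u x \<ge> q \<and> norm x \<le> R} x \<le> g x" for x
    using p nonneg by (auto simp: g_def indicator_def)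
  have u0: "u 0 = 0" using hom[of 2 0] by simp
  \<comment> \<open>Homogeneity forces u to vanish at the origin, so by continuity u stays below p >
    0 nearby and the ramp is zero there.\<close>
  obtain \<delta> where \<delta>: "\<delta> > 0" "\<And>x. norm x < \<delta> \<Longrightarrow> \<bar>u x\<bar> < p"
    using u p(1) u0 unfolding continuous_on_iff by (metis UNIV_I dist_0_norm dist_commute real_norm_def)
  have zero: "\<exists>\<delta>>0. \<exists>K. \<forall>x::'a. norm x < \<delta> \<or> norm x > K \<longrightarrow> g x = 0"
  proof (rule exI[of _ \<delta>], intro conjI exI[of _ "R + 1"] allI impI)
    fix x :: 'a assume "norm x < \<delta> \<or> R + 1 < norm x"
    then show "g x = 0"
    proof
      assume "norm x < \<delta>"
      then have "x \<notin> {x. u x > p}" using \<delta>(2)[of x] by auto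
      then show ?thesis using upper[of x] nonneg[of x] by simp
    qed (simp add: g_def max_def)
  qed (fact \<delta>)
  have [measurable]: "u \<in> borel_measurable borel" "g \<in> borel_measurable borel"
    using u cont by (auto intro: borel_measurable_continuous_onI)
  have J: "0 \<le> radial_moment v" for v by (simp add: radial_moment_def)
  have level: "{x. u x > c} \<in> fmeasurable N" "measure N {x. u x > c} = c powr (- \<alpha>) * radial_moment u"
    if "c > 0" for c
    using emeasure_homogeneous_level[OF u hom that] J[of u]
    by (auto simp: fmeasurable_def sets_N measure_def)
  have tail: "{x. norm x > R} \<in> fmeasurable N"
    "measure N {x. norm x > R} = R powr (- \<alpha>) * radial_moment norm"
    using emeasure_homogeneous_level[of norm R] J[of norm] R
    by (auto simp: fmeasurable_def sets_N measure_def continuous_on_norm_id)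
  have ind: "integrable N (indicat_real {x. u x > p})"
    using level(1)[OF p(1)] by (auto simp: fmeasurable_def)
  have int: "integrable N g"
    by (rule Bochner_Integration.integrable_bound[OF ind])
      (use nonneg upper in \<open>auto simp: abs_of_nonneg\<close>)
  have "integral\<^sup>L N g \<le> p powr (- \<alpha>) * radial_moment u"
    using integral_mono[OF int ind] upper level[OF p(1)] by (simp add: space_N)
  moreover have "q powr (- \<alpha>) * radial_moment u - R powr (- \<alpha>) * radial_moment norm \<le> integral\<^sup>L N g"
  proof -
    have q: "q > 0" using p by simp
    \<comment> \<open>This difference lies below g: beyond R it is at most 0. It involves only
      superlevel sets of the homogeneous functions u and \<open>norm\<close>, whose measures are
      known, and avoids their intersection.\<close>
    have "integrable N (\<lambda>x. indicat_real {x. u x > q} x - indicat_real {x. norm x > R} x)"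
      using level(1)[OF q] tail(1) by (auto simp: fmeasurable_def)
    moreover have "indicat_real {x. u x > q} x - indicat_real {x. norm x > R} x \<le> g x" for x
      using lower[of x] nonneg[of x] by (auto simp: indicator_def split: if_splits)
    ultimately have "(\<integral>x. indicat_real {x. u x > q} x - indicat_real {x. norm x > R} x \<partial>N) \<le> integral\<^sup>L N g"
      by (intro integral_mono int)
    then show ?thesis
      using level[OF q] tail by (simp add: fmeasurable_def space_N)
  qed
  ultimately show ?thesis using that cont zero nonneg upper lower by blast
qed

text \<open>Functionals such as \<open>x\<^sub>1 + x\<^sub>2\<close> do not extend continuously to the infinite points of
  the compactified plane, so \<open>{u > 1}\<close> is truncated at a large radius and the remainder is
  controlled by tightness.\<close>

theorem tail_limit_homogeneous:
  fixes X :: "'o \<Rightarrow> 'a" and u :: "'a \<Rightarrow> real"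
  assumes M: "prob_space M" and X [measurable]: "X \<in> borel_measurable M"
    and b: "\<And>s. s > 0 \<Longrightarrow> 0 \<le> b s"
    and vague: "\<And>g. continuous_on UNIV g \<Longrightarrow>
      \<exists>\<delta>>0. \<exists>K. \<forall>x. norm x < \<delta> \<or> norm x > K \<longrightarrow> g x = 0 \<Longrightarrow>
      ((\<lambda>s. b s * (\<integral>\<omega>. g (X \<omega> /\<^sub>R s) \<partial>M)) \<longlongrightarrow> integral\<^sup>L N g) at_top"
    and tight: "\<And>t. t > 0 \<Longrightarrow> \<forall>\<^sub>F s in at_top.
      b s * measure M {\<omega> \<in> space M. norm (X \<omega>) > s * t} \<le> C * t powr (- \<alpha>)"
    and u: "continuous_on UNIV u" and hom: "\<And>t x. t > 0 \<Longrightarrow> u (t *\<^sub>R x) = t * u x"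
  shows "((\<lambda>s. b s * measure M {\<omega> \<in> space M. u (X \<omega>) > s}) \<longlongrightarrow> radial_moment u) at_top"
proof (rule order_tendstoI)
  interpret M: prob_space M by fact
  let ?J = "radial_moment u"
  have [measurable]: "u \<in> borel_measurable borel"
    using u by (rule borel_measurable_continuous_onI)
  have hom': "u (x /\<^sub>R s) = u x / s" if "s > 0" for x s
    using hom[of "inverse s" x] that by (simp add: divide_inverse mult.commute)
  have to_1: "(\<lambda>n. (1 + c / real (Suc n)) powr (- \<alpha>)) \<longlonglongrightarrow> 1" for c :: real
    by real_asymp
  have to_0: "(\<lambda>n. real (Suc n) powr (- \<alpha>)) \<longlonglongrightarrow> 0"
    using alpha_pos by real_asymp
  have ev [measurable]: "{\<omega> \<in> space M. u (X \<omega>) > s} \<in> sets M"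
    "{\<omega> \<in> space M. norm (X \<omega>) > s} \<in> sets M" for s
    by measurable
  have ind: "integrable M (indicat_real A)" if "A \<in> sets M" for A
    using that by (simp add: integrable_indicator_iff less_top[symmetric])
  have int: "integrable M (\<lambda>\<omega>. g (X \<omega> /\<^sub>R s))"
    if "continuous_on UNIV g" "\<And>x. 0 \<le> g x" "\<And>x. g x \<le> indicator S x" for g :: "'a \<Rightarrow> real" and S s
  proof -
    have [measurable]: "g \<in> borel_measurable borel"
      using that by (intro borel_measurable_continuous_onI)
    have "\<bar>g x\<bar> \<le> 1" for x
      using that(2,3)[of x] by (cases "x \<in> S") auto
    then show ?thesis by (intro M.integrable_const_bound[of _ 1]) auto
  qed
  {
    fix a assume "a < ?J"
    \<comment> \<open>Lower bound: with p = 1, q = 1 + 1/(n+1) and R = n+1, the lower estimate for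
      the integral of the test function tends to \<open>?J\<close>, so some n brings it above
      a.\<close>
    have "(\<lambda>n. (1 + 1 / real (Suc n)) powr (- \<alpha>) * ?J
        - real (Suc n) powr (- \<alpha>) * radial_moment norm) \<longlonglongrightarrow> 1 * ?J - 0 * radial_moment norm"
      by (intro tendsto_intros to_1 to_0)
    then have "\<forall>\<^sub>F n in sequentially. a < (1 + 1 / real (Suc n)) powr (- \<alpha>) * ?J
        - real (Suc n) powr (- \<alpha>) * radial_moment norm"
      using \<open>a < ?J\<close> by (intro order_tendstoD(1)) auto
    then obtain n where n: "a < (1 + 1 / real (Suc n)) powr (- \<alpha>) * ?J
        - real (Suc n) powr (- \<alpha>) * radial_moment norm"
      by (auto simp: eventually_sequentially)
    have pq: "(0::real) < 1" "1 < 1 + 1 / real (Suc n)" "0 < real (Suc n)" by auto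
    obtain g where g: "continuous_on UNIV g"
        "\<exists>\<delta>>0. \<exists>K. \<forall>x. norm x < \<delta> \<or> norm x > K \<longrightarrow> g x = 0"
        "\<And>x. 0 \<le> g x" "\<And>x. g x \<le> indicator {x. u x > 1} x"
        "\<And>x. indicator {x. u x \<ge> 1 + 1 / real (Suc n) \<and> norm x \<le> real (Suc n)} x \<le> g x"
        "(1 + 1 / real (Suc n)) powr (- \<alpha>) * ?J
           - real (Suc n) powr (- \<alpha>) * radial_moment norm \<le> integral\<^sup>L N g"
        "integral\<^sup>L N g \<le> 1 powr (- \<alpha>) * ?J"
      by (rule radial_test_function[OF u _ pq]) (rule hom that; assumption)+
    have "\<forall>\<^sub>F s in at_top. a < b s * (\<integral>\<omega>. g (X \<omega> /\<^sub>R s) \<partial>M)"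
      using order_tendstoD(1)[OF vague[OF g(1,2)]] g(6) n by force
    then show "\<forall>\<^sub>F s in at_top. a < b s * measure M {\<omega> \<in> space M. u (X \<omega>) > s}"
      using eventually_gt_at_top[of 0]
    proof eventually_elim
      case (elim s)
      have "(\<integral>\<omega>. g (X \<omega> /\<^sub>R s) \<partial>M) \<le> (\<integral>\<omega>. indicator {\<omega> \<in> space M. u (X \<omega>) > s} \<omega> \<partial>M)"
      proof (rule integral_mono)
        show "integrable M (\<lambda>\<omega>. g (X \<omega> /\<^sub>R s))" by (rule int[OF g(1,3,4)])
        show "g (X \<omega> /\<^sub>R s) \<le> indicat_real {\<omega> \<in> space M. u (X \<omega>) > s} \<omega>" if "\<omega> \<in> space M" for \<omega>
          using g(4)[of "X \<omega> /\<^sub>R s"] that \<open>0 < s\<close> by (simp add: hom' indicator_def)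
      qed (intro ind ev)
      also have "\<dots> = measure M {\<omega> \<in> space M. u (X \<omega>) > s}" by simp
      finally show ?case
        using elim b[of s] by (meson less_le_trans mult_left_mono)
    qed
  next
    fix a assume "a > ?J"
    \<comment> \<open>Upper bound: q = 1 and p = 1 - 1/(2(n+1)), where the factor 1/2 keeps p
      positive at n = 0. Since C does not depend on the radius, the mass beyond n+1 also becomes
      negligible, and n can be fixed before s grows.\<close>
    have "(\<lambda>n. (1 + (- (1/2)) / real (Suc n)) powr (- \<alpha>) * ?J
        + C * real (Suc n) powr (- \<alpha>)) \<longlonglongrightarrow> 1 * ?J + C * 0"
      by (intro tendsto_intros to_1 to_0)
    then have "\<forall>\<^sub>F n in sequentially. (1 + (- (1/2)) / real (Suc n)) powr (- \<alpha>) * ?J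
        + C * real (Suc n) powr (- \<alpha>) < a"
      using \<open>a > ?J\<close> by (intro order_tendstoD(2)) auto
    then obtain n where n: "(1 + (- (1/2)) / real (Suc n)) powr (- \<alpha>) * ?J
        + C * real (Suc n) powr (- \<alpha>) < a"
      by (auto simp: eventually_sequentially)
    have pq: "0 < 1 + (- (1/2)) / real (Suc n)" "1 + (- (1/2)) / real (Suc n) < 1" "0 < real (Suc n)"
      by (auto simp: field_simps)
    obtain g where g: "continuous_on UNIV g"
        "\<exists>\<delta>>0. \<exists>K. \<forall>x. norm x < \<delta> \<or> norm x > K \<longrightarrow> g x = 0"
        "\<And>x. 0 \<le> g x" "\<And>x. g x \<le> indicator {x. u x > 1 + (- (1/2)) / real (Suc n)} x"
        "\<And>x. indicator {x. u x \<ge> 1 \<and> norm x \<le> real (Suc n)} x \<le> g x"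
        "1 powr (- \<alpha>) * ?J - real (Suc n) powr (- \<alpha>) * radial_moment norm \<le> integral\<^sup>L N g"
        "integral\<^sup>L N g \<le> (1 + (- (1/2)) / real (Suc n)) powr (- \<alpha>) * ?J"
      by (rule radial_test_function[OF u _ pq]) (rule hom that; assumption)+
    have "\<forall>\<^sub>F s in at_top. b s * (\<integral>\<omega>. g (X \<omega> /\<^sub>R s) \<partial>M) < a - C * real (Suc n) powr (- \<alpha>)"
      using g(7) n by (intro order_tendstoD(2)[OF vague[OF g(1,2)]]) linarith
    then show "\<forall>\<^sub>F s in at_top. b s * measure M {\<omega> \<in> space M. u (X \<omega>) > s} < a"
      using eventually_gt_at_top[of 0] tight[OF pq(3)]
    proof eventually_elim
      case (elim s)
      let ?T = "{\<omega> \<in> space M. norm (X \<omega>) > s * real (Suc n)}"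
      have "measure M {\<omega> \<in> space M. u (X \<omega>) > s} = (\<integral>\<omega>. indicator {\<omega> \<in> space M. u (X \<omega>) > s} \<omega> \<partial>M)"
        by simp
      \<comment> \<open>On the event u(X) > s, either X/s lies within radius n+1, where g equals 1,
        or the outcome belongs to \<open>?T\<close>.\<close>
      also have "\<dots> \<le> (\<integral>\<omega>. g (X \<omega> /\<^sub>R s) + indicator ?T \<omega> \<partial>M)"
      proof (rule integral_mono)
        show "integrable M (\<lambda>\<omega>. g (X \<omega> /\<^sub>R s) + indicator ?T \<omega>)"
          by (intro Bochner_Integration.integrable_add int[OF g(1,3,4)] ind ev)
        show "indicat_real {\<omega> \<in> space M. u (X \<omega>) > s} \<omega> \<le> g (X \<omega> /\<^sub>R s) + indicator ?T \<omega>"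
          if "\<omega> \<in> space M" for \<omega>
        proof (cases "norm (X \<omega>) > s * real (Suc n)")
          case True
          then show ?thesis using that g(3)[of "X \<omega> /\<^sub>R s"] by (simp add: indicator_def)
        next
          case False
          then have "norm (X \<omega> /\<^sub>R s) \<le> real (Suc n)"
            using \<open>0 < s\<close> by (simp add: field_simps)
          then show ?thesis
            using g(5)[of "X \<omega> /\<^sub>R s"] g(3)[of "X \<omega> /\<^sub>R s"] that \<open>0 < s\<close>
            by (auto simp: hom' indicator_def split: if_splits)
        qed
      qed (intro ind ev)
      also have "\<dots> = (\<integral>\<omega>. g (X \<omega> /\<^sub>R s) \<partial>M) + measure M ?T"
        using int[OF g(1,3,4), of s] ind[OF ev(2)] by (subst Bochner_Integration.integral_add) auto
      finally have "b s * measure M {\<omega> \<in> space M. u (X \<omega>) > s}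
          \<le> b s * ((\<integral>\<omega>. g (X \<omega> /\<^sub>R s) \<partial>M) + measure M ?T)"
        using b[OF \<open>0 < s\<close>] by (rule mult_left_mono)
      then have "b s * measure M {\<omega> \<in> space M. u (X \<omega>) > s}
          \<le> b s * (\<integral>\<omega>. g (X \<omega> /\<^sub>R s) \<partial>M) + b s * measure M ?T"
        by (simp only: distrib_left)
      then show ?case using elim by linarith
    qed
  }
qed

end

section \<open>The real plane inside the extended plane\<close>

text \<open>A total left inverse of \<open>embed_plane\<close>. Infinite coordinates become 0, which
  is harmless because exponent measures do not charge infinite points.\<close>

definition plane_part :: "ereal \<times> ereal \<Rightarrow> real \<times> real" where
  "plane_part = map_prod real_of_ereal real_of_ereal"

lemma plane_part_embed_plane [simp]: "plane_part (embed_plane x) = x"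
  by (cases x) (simp add: plane_part_def embed_plane_def)

lemma embed_plane_eq_0_iff: "embed_plane x = (0, 0) \<longleftrightarrow> x = 0"
  by (cases x) (simp add: embed_plane_def zero_prod_def)

lemma open_range_embed_plane: "open (range embed_plane)"
proof -
  have "range embed_plane = range ereal \<times> range ereal"
    by (simp add: embed_plane_def map_prod_surj_on flip: UNIV_Times_UNIV)
  then show ?thesis by (simp add: open_Times open_ereal del: range_ereal)
qed

lemma continuous_on_embed_plane: "continuous_on S embed_plane"
proof -
  have "continuous_on S (\<lambda>x. (ereal (fst x), ereal (snd x)))"
    by (intro continuous_intros)
  then show ?thesis by (simp add: embed_plane_def map_prod_def case_prod_unfold)
qed

lemma continuous_on_plane_part: "continuous_on (range embed_plane) plane_part"
proof -
  have "isCont plane_part z" if "z \<in> range embed_plane" for z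
  proof -
    have "\<bar>fst z\<bar> \<noteq> \<infinity>" "\<bar>snd z\<bar> \<noteq> \<infinity>" using that by (auto simp: embed_plane_def)
    then have "isCont (\<lambda>z. (real_of_ereal (fst z), real_of_ereal (snd z))) z"
      using isCont_o2[OF isCont_fst[OF continuous_ident] continuous_at_of_ereal]
        isCont_o2[OF isCont_snd[OF continuous_ident] continuous_at_of_ereal]
      by (intro isCont_Pair)
    then show ?thesis by (simp add: plane_part_def map_prod_def case_prod_unfold)
  qed
  then show ?thesis by (simp add: continuous_at_imp_continuous_on)
qed

lemma measurable_embed_plane [measurable]: "embed_plane \<in> borel_measurable borel"
  by (intro borel_measurable_continuous_onI continuous_on_embed_plane)

lemma measurable_plane_part [measurable]: "plane_part \<in> borel_measurable borel"
proof -
  have "(\<lambda>z. (real_of_ereal (fst z), real_of_ereal (snd z))) \<in> borel_measurable borel"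
    by (simp flip: borel_prod)
  then show ?thesis by (simp add: plane_part_def map_prod_def case_prod_unfold)
qed

text \<open>Since f vanishes at the origin, restricting the law to the punctured plane does not
  change the integral.\<close>

lemma integral_scaled_law:
  fixes f :: "ereal \<times> ereal \<Rightarrow> real"
  assumes [measurable]: "X \<in> borel_measurable M" "f \<in> borel_measurable borel"
    and f0: "f (0, 0) = 0" and b: "0 \<le> b s"
  shows "integral\<^sup>L (scaled_law M b X s) f = b s * (\<integral>\<omega>. f (embed_plane (X \<omega> /\<^sub>R s)) \<partial>M)"
proof -
  define D where "D = distr M borel (\<lambda>\<omega>. embed_plane (X \<omega> /\<^sub>R s))"
  have E: "punctured_plane \<in> sets borel"
    by (simp add: punctured_plane_def)
  \<comment> \<open>Scaling is recast as a constant density so that Bochner integrals can be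
    evaluated.\<close>
  have "scaled_law M b X s = density (restrict_space D punctured_plane) (\<lambda>_. ennreal (b s))"
    unfolding scaled_law_def D_def[symmetric]
    by (rule measure_eqI) (auto simp: emeasure_density_const)
  then have "integral\<^sup>L (scaled_law M b X s) f = b s * integral\<^sup>L (restrict_space D punctured_plane) f"
    using b by (simp add: integral_density D_def measurable_restrict_space1)
  also have "integral\<^sup>L (restrict_space D punctured_plane) f = (\<integral>z. indicator punctured_plane z *\<^sub>R f z \<partial>D)"
    using E by (intro integral_restrict_space) (simp add: D_def)
  also have "\<dots> = integral\<^sup>L D f"
    using f0 by (intro Bochner_Integration.integral_cong) (auto simp: punctured_plane_def indicator_def)
  also have "\<dots> = (\<integral>\<omega>. f (embed_plane (X \<omega> /\<^sub>R s)) \<partial>M)"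
    unfolding D_def by (intro integral_distr) measurable
  finally show ?thesis .
qed

section \<open>Transfer of the exponent measure to the real plane\<close>

text \<open>"Finite" refers to the points that carry the mass; the total mass may be infinite near
  the origin.\<close>

locale finite_exponent_measure =
  fixes \<nu> :: "(ereal \<times> ereal) measure"
  assumes sets_nu: "sets \<nu> = sets (restrict_space borel punctured_plane)"
    and infinite_null: "emeasure \<nu> (punctured_plane - range embed_plane) = 0"
begin

definition plane_measure :: "(real \<times> real) measure" where
  "plane_measure = distr \<nu> borel plane_part"

lemma space_nu: "space \<nu> = punctured_plane"
  using sets_eq_imp_space_eq[OF sets_nu] by (simp add: space_restrict_space)

lemma borel_measurable_nu: "f \<in> measurable borel K \<Longrightarrow> f \<in> measurable \<nu> K"
  unfolding measurable_cong_sets[OF sets_nu refl] by (rule measurable_restrict_space1)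

lemma AE_finite: "AE z in \<nu>. z \<in> range embed_plane"
proof (rule AE_I)
  have "punctured_plane - range embed_plane \<in> sets \<nu>"
    using open_range_embed_plane
    by (auto simp: sets_nu sets_restrict_space punctured_plane_def intro!: image_eqI[of _ _ "- range embed_plane"])
  then show "punctured_plane - range embed_plane \<in> sets \<nu>" .
qed (auto simp: space_nu infinite_null)

text \<open>The preimage of A under \<open>plane_part\<close> and the image of A under
  \<open>embed_plane\<close> differ only in infinite points, a null set. Excluding 0 from A keeps
  the image inside the space of \<nu>.\<close>

lemma emeasure_plane_measure:
  assumes A: "A \<in> sets borel" and "0 \<notin> A"
  shows "emeasure plane_measure A = emeasure \<nu> (embed_plane ` A)"
proof -
  have part: "plane_part \<in> measurable \<nu> borel"
    by (intro borel_measurable_nu measurable_plane_part)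
  have img: "embed_plane ` A = (plane_part -` A \<inter> range embed_plane) \<inter> punctured_plane"
    using assms(2) by (auto simp: punctured_plane_def embed_plane_eq_0_iff dest!: sym[of "(0, 0)"])
  have "plane_part -` A \<inter> range embed_plane \<in> sets borel"
    using measurable_sets[OF measurable_plane_part A] open_range_embed_plane by auto
  then have "embed_plane ` A \<in> sets \<nu>"
    unfolding img sets_nu sets_restrict_space by auto
  moreover have "plane_part -` A \<inter> space \<nu> \<in> sets \<nu>"
    using part A by (rule measurable_sets)
  moreover have "AE z in \<nu>. z \<in> plane_part -` A \<inter> space \<nu> \<longleftrightarrow> z \<in> embed_plane ` A"
    using AE_finite AE_space by eventually_elim (auto simp: img space_nu)
  ultimately have "emeasure \<nu> (plane_part -` A \<inter> space \<nu>) = emeasure \<nu> (embed_plane ` A)"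
    by (intro emeasure_eq_AE)
  then show ?thesis
    unfolding plane_measure_def using part A by (simp add: emeasure_distr)
qed

text \<open>Support in an annulus lets g be extended by 0 to the points at infinity, which gives an
  admissible test function for vague convergence.\<close>

lemma vague_tendsto_plane_measure:
  fixes g :: "real \<times> real \<Rightarrow> real"
  assumes X: "X \<in> borel_measurable M" and b: "\<And>s. s > 0 \<Longrightarrow> 0 \<le> b s"
    and vague: "vague_tendsto punctured_plane (scaled_law M b X) \<nu> at_top"
    and g: "continuous_on UNIV g"
    and supp: "\<exists>\<delta>>0. \<exists>K. \<forall>x. norm x < \<delta> \<or> norm x > K \<longrightarrow> g x = 0"
  shows "((\<lambda>s. b s * (\<integral>\<omega>. g (X \<omega> /\<^sub>R s) \<partial>M)) \<longlongrightarrow> integral\<^sup>L plane_measure g) at_top"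
proof -
  obtain \<delta> K where \<delta>: "\<delta> > 0" and gz: "\<And>x. norm x < \<delta> \<or> norm x > K \<Longrightarrow> g x = 0"
    using supp by blast
  define f where "f z = (if z \<in> range embed_plane then g (plane_part z) else 0)" for z
  define C where "C = embed_plane ` (cball 0 K - ball 0 \<delta>)"
  have comp: "compact (embed_plane ` S)" if "compact S" for S
    using that by (intro compact_continuous_image continuous_on_embed_plane)
  have C: "compact C" "C \<subseteq> punctured_plane"
    unfolding C_def using \<delta>
    by (auto intro!: comp compact_diff simp: punctured_plane_def embed_plane_eq_0_iff dest!: sym[of "(0, 0)"])
  have f_supp: "f z = 0" if "z \<notin> C" for z
  proof (cases "z \<in> range embed_plane")
    case True
    then obtain x where x: "z = embed_plane x" by auto
    then have "x \<notin> cball 0 K - ball 0 \<delta>" using that by (auto simp: C_def)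
    then show ?thesis using gz[of x] x by (auto simp: f_def)
  qed (simp add: f_def)
  have cont: "continuous_on UNIV f"
  proof -
    have "continuous_on (range embed_plane) (\<lambda>z. g (plane_part z))"
      by (rule continuous_on_compose2[OF g continuous_on_plane_part]) auto
    then have "continuous_on (range embed_plane) f"
      by (rule continuous_on_eq) (simp add: f_def)
    \<comment> \<open>The image C of the closed annulus is compact, hence closed, so its complement
      and the open range of \<open>embed_plane\<close> form an open cover; f is continuous on each
      piece.\<close>
    moreover have "continuous_on (- C) f"
      using f_supp by (intro continuous_on_eq[OF continuous_on_const[of _ 0]]) auto
    ultimately have "continuous_on (range embed_plane \<union> - C) f"
      using C(1) open_range_embed_plane
      by (intro continuous_on_open_Un) (auto intro: compact_imp_closed)
    moreover have "range embed_plane \<union> - C = UNIV" by (auto simp: C_def)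
    ultimately show ?thesis by simp
  qed
  have fm: "f \<in> borel_measurable borel"
    using cont by (rule borel_measurable_continuous_onI)
  have gm: "g \<in> borel_measurable borel"
    using g by (rule borel_measurable_continuous_onI)
  have "continuous_on punctured_plane f"
    using cont continuous_on_subset by blast
  then have "((\<lambda>s. integral\<^sup>L (scaled_law M b X s) f) \<longlongrightarrow> integral\<^sup>L \<nu> f) at_top"
    using vague C f_supp unfolding vague_tendsto_def by blast
  moreover have "\<forall>\<^sub>F s in at_top. integral\<^sup>L (scaled_law M b X s) f = b s * (\<integral>\<omega>. g (X \<omega> /\<^sub>R s) \<partial>M)"
    using eventually_gt_at_top[of 0]
  proof eventually_elim
    case (elim s)
    have "f (0, 0) = 0" using C(2) by (intro f_supp) (auto simp: punctured_plane_def)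
    then show ?case using integral_scaled_law[OF X fm, where b=b and s=s] b[OF elim] by (simp add: f_def)
  qed
  moreover have "integral\<^sup>L \<nu> f = integral\<^sup>L plane_measure g"
  proof -
    have "integral\<^sup>L plane_measure g = (\<integral>z. g (plane_part z) \<partial>\<nu>)"
      unfolding plane_measure_def
      by (intro integral_distr borel_measurable_nu measurable_plane_part gm)
    also have "\<dots> = integral\<^sup>L \<nu> f"
      using AE_finite
      by (intro integral_cong_AE borel_measurable_nu fm measurable_compose[OF measurable_plane_part gm])
        (auto simp: f_def)
    finally show ?thesis by simp
  qed
  ultimately show ?thesis by (simp add: tendsto_cong)
qed

end

section \<open>Marginal tails and tightness\<close>

text \<open>\<open>V_set\<close> gives a limit for each t separately; slow variation ties them to
  the limit at t = 1, since b(s)/b(s t) tends to t^(-\<alpha>). The single constant l is what makes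
  the tightness bound uniform in t.\<close>

lemma V_set_tail_limit:
  assumes M: "prob_space M" and b: "normalizing_function \<alpha> b" and X: "X \<in> V_set M b"
  obtains l where "\<And>t. t > 0 \<Longrightarrow>
    ((\<lambda>s. b s * measure M {\<omega> \<in> space M. \<bar>X \<omega>\<bar> > s * t}) \<longlongrightarrow> l * t powr (- \<alpha>)) at_top"
proof -
  interpret M: prob_space M by fact
  have [measurable]: "X \<in> borel_measurable M" using X by (simp add: V_set_def)
  obtain L where L: "slowly_varying L" and bL: "\<And>s. s > 0 \<Longrightarrow> b s = s powr \<alpha> * L s"
    using b by (auto simp: normalizing_function_def)
  have L_pos: "\<And>s. s > 0 \<Longrightarrow> L s > 0" using L by (simp add: slowly_varying_def)
  define F where "F s = b s * measure M {\<omega> \<in> space M. \<bar>X \<omega>\<bar> > s}" for s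
  obtain l1 l2 where
    l: "((\<lambda>s. b s * measure M {\<omega> \<in> space M. X \<omega> > s * 1}) \<longlongrightarrow> l1) at_top"
       "((\<lambda>s. b s * measure M {\<omega> \<in> space M. X \<omega> < - (s * 1)}) \<longlongrightarrow> l2) at_top"
    using X zero_less_one unfolding V_set_def by blast
  have "(F \<longlongrightarrow> l1 + l2) at_top"
  proof (rule Lim_transform_eventually[OF tendsto_add[OF l]])
    show "\<forall>\<^sub>F s in at_top. b s * measure M {\<omega> \<in> space M. X \<omega> > s * 1}
        + b s * measure M {\<omega> \<in> space M. X \<omega> < - (s * 1)} = F s"
      using eventually_gt_at_top[of 0]
    proof eventually_elim
      case (elim s)
      have "{\<omega> \<in> space M. \<bar>X \<omega>\<bar> > s} = {\<omega> \<in> space M. X \<omega> > s} \<union> {\<omega> \<in> space M. X \<omega> < - s}"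
        using elim by auto
      also have "measure M \<dots> = measure M {\<omega> \<in> space M. X \<omega> > s} + measure M {\<omega> \<in> space M. X \<omega> < - s}"
        using elim by (intro M.finite_measure_Union) auto
      finally show ?case by (simp add: F_def algebra_simps)
    qed
  qed
  note F = this
  show thesis
  proof (rule that)
    fix t :: real assume t: "t > 0"
    have "filterlim (\<lambda>s. s * t) at_top at_top"
      using t by (intro filterlim_at_top_mult_tendsto_pos[OF tendsto_const] filterlim_ident)
    then have Ft: "((\<lambda>s. F (s * t)) \<longlongrightarrow> l1 + l2) at_top"
      by (rule filterlim_compose[OF F])
    \<comment> \<open>For s > 0 the factor in front of F is b(s)/b(s t), exchanging the
      normalization at s t for the one at s.\<close>
    have "((\<lambda>s. t powr (- \<alpha>) * inverse (L (s * t) / L s) * F (s * t))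
        \<longlongrightarrow> t powr (- \<alpha>) * inverse 1 * (l1 + l2)) at_top"
      using L t by (intro tendsto_intros Ft) (auto simp: slowly_varying_def)
    moreover have "\<forall>\<^sub>F s in at_top. t powr (- \<alpha>) * inverse (L (s * t) / L s) * F (s * t)
        = b s * measure M {\<omega> \<in> space M. \<bar>X \<omega>\<bar> > s * t}"
      using eventually_gt_at_top[of 0]
    proof eventually_elim
      case (elim s)
      have "t powr (- \<alpha>) * inverse (L (s * t) / L s) * b (s * t) = b s"
        using elim t L_pos[of s] L_pos[of "s * t"]
        by (simp add: bL powr_mult powr_minus field_simps)
      then show ?case by (simp add: F_def flip: mult.assoc)
    qed
    ultimately show "((\<lambda>s. b s * measure M {\<omega> \<in> space M. \<bar>X \<omega>\<bar> > s * t})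
        \<longlongrightarrow> (l1 + l2) * t powr (- \<alpha>)) at_top"
      by (auto intro: Lim_transform_eventually simp: mult.commute)
  qed
qed

text \<open>The norm of a pair is at most the sum of the absolute values, so if it exceeds s t, one
  coordinate exceeds s t / 2.\<close>

lemma V_set_tight_pair:
  assumes M: "prob_space M" and b: "normalizing_function \<alpha> b"
    and X: "X1 \<in> V_set M b" and Y: "X2 \<in> V_set M b"
  obtains C where "\<And>t. t > 0 \<Longrightarrow> \<forall>\<^sub>F s in at_top.
    b s * measure M {\<omega> \<in> space M. norm (X1 \<omega>, X2 \<omega>) > s * t} \<le> C * t powr (- \<alpha>)"
proof -
  interpret M: prob_space M by fact
  have [measurable]: "X1 \<in> borel_measurable M" "X2 \<in> borel_measurable M"
    using X Y by (simp_all add: V_set_def)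
  have b_nonneg: "b s \<ge> 0" if "s > 0" for s
    using b that by (auto simp: normalizing_function_def slowly_varying_def less_imp_le)
  obtain l1 where l1: "\<And>t. t > 0 \<Longrightarrow>
    ((\<lambda>s. b s * measure M {\<omega> \<in> space M. \<bar>X1 \<omega>\<bar> > s * t}) \<longlongrightarrow> l1 * t powr (- \<alpha>)) at_top"
    using V_set_tail_limit[OF M b X] by blast
  obtain l2 where l2: "\<And>t. t > 0 \<Longrightarrow>
    ((\<lambda>s. b s * measure M {\<omega> \<in> space M. \<bar>X2 \<omega>\<bar> > s * t}) \<longlongrightarrow> l2 * t powr (- \<alpha>)) at_top"
    using V_set_tail_limit[OF M b Y] by blast
  show thesis
  proof (rule that)
    fix t :: real assume t: "t > 0"
    \<comment> \<open>The added 1 leaves strict room above the limit, so the bound holds eventually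
      in s.\<close>
    have "l1 * (t / 2) powr (- \<alpha>) + l2 * (t / 2) powr (- \<alpha>) < (l1 + l2 + 1) * (t / 2) powr (- \<alpha>)"
      using t by (simp add: distrib_right)
    also have "\<dots> = (l1 + l2 + 1) * (1 / 2) powr (- \<alpha>) * t powr (- \<alpha>)"
      using t powr_mult[of t "1 / 2" "- \<alpha>"] by simp
    finally have "\<forall>\<^sub>F s in at_top. b s * measure M {\<omega> \<in> space M. \<bar>X1 \<omega>\<bar> > s * (t / 2)}
        + b s * measure M {\<omega> \<in> space M. \<bar>X2 \<omega>\<bar> > s * (t / 2)}
        < (l1 + l2 + 1) * (1 / 2) powr (- \<alpha>) * t powr (- \<alpha>)"
      using t by (intro order_tendstoD(2)[OF tendsto_add[OF l1 l2]]) auto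
    then show "\<forall>\<^sub>F s in at_top. b s * measure M {\<omega> \<in> space M. norm (X1 \<omega>, X2 \<omega>) > s * t}
        \<le> (l1 + l2 + 1) * (1 / 2) powr (- \<alpha>) * t powr (- \<alpha>)"
      using eventually_gt_at_top[of 0]
    proof eventually_elim
      case (elim s)
      have "{\<omega> \<in> space M. norm (X1 \<omega>, X2 \<omega>) > s * t}
          \<subseteq> {\<omega> \<in> space M. \<bar>X1 \<omega>\<bar> > s * (t / 2)} \<union> {\<omega> \<in> space M. \<bar>X2 \<omega>\<bar> > s * (t / 2)}"
      proof safe
        fix \<omega> assume "s * t < norm (X1 \<omega>, X2 \<omega>)" "\<not> s * (t / 2) < \<bar>X2 \<omega>\<bar>"
        then show "s * (t / 2) < \<bar>X1 \<omega>\<bar>"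
          using norm_Pair_le[of "X1 \<omega>" "X2 \<omega>"] by (simp add: algebra_simps)
      qed
      then have "measure M {\<omega> \<in> space M. norm (X1 \<omega>, X2 \<omega>) > s * t}
          \<le> measure M ({\<omega> \<in> space M. \<bar>X1 \<omega>\<bar> > s * (t / 2)} \<union> {\<omega> \<in> space M. \<bar>X2 \<omega>\<bar> > s * (t / 2)})"
        by (intro M.finite_measure_mono) auto
      also have "\<dots> \<le> measure M {\<omega> \<in> space M. \<bar>X1 \<omega>\<bar> > s * (t / 2)}
          + measure M {\<omega> \<in> space M. \<bar>X2 \<omega>\<bar> > s * (t / 2)}"
        by (intro measure_Un_le) auto
      finally show ?case
        using elim mult_left_mono[OF _ b_nonneg[of s]] by (fastforce simp: distrib_left)
    qed
  qed
qed

section \<open>The parallelogram law\<close>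

text \<open>The two memberships belong to the claim because \<open>norm_b\<close> is defined through
  \<open>Lim\<close> and has its meaning only where the limit exists.\<close>

theorem theorem4:
  fixes M :: "'o measure" and b :: "real \<Rightarrow> real" and X1 X2 :: "'o \<Rightarrow> real"
    and \<nu> :: "(ereal \<times> ereal) measure" and H :: "(real \<times> real) measure"
  assumes "prob_space M"
    and "normalizing_function 2 b"
    and "X1 \<in> V_set M b - N_set M b"
    and "X2 \<in> V_set M b - N_set M b"
    and "regularly_varying_with M b (\<lambda>\<omega>. (X1 \<omega>, X2 \<omega>)) \<nu>"
    and "angular_measure_of 2 \<nu> H"
  shows "(\<lambda>\<omega>. X1 \<omega> + X2 \<omega>) \<in> V_set M b \<and> (\<lambda>\<omega>. X1 \<omega> - X2 \<omega>) \<in> V_set M b \<and>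
         (norm_b M b 2 (\<lambda>\<omega>. X1 \<omega> + X2 \<omega>))\<^sup>2 + (norm_b M b 2 (\<lambda>\<omega>. X1 \<omega> - X2 \<omega>))\<^sup>2 =
         2 * (norm_b M b 2 X1)\<^sup>2 + 2 * (norm_b M b 2 X2)\<^sup>2"
proof -
  let ?X = "\<lambda>\<omega>. (X1 \<omega>, X2 \<omega>)"
  have V: "X1 \<in> V_set M b" "X2 \<in> V_set M b" using assms(3,4) by auto
  have rv: "?X \<in> borel_measurable M" "radon_measure_on punctured_plane \<nu>"
    "emeasure \<nu> (punctured_plane - range embed_plane) = 0"
    "vague_tendsto punctured_plane (scaled_law M b ?X) \<nu> at_top"
    using assms(5) by (auto simp: regularly_varying_with_def)
  have ang: "sets H = sets (restrict_space borel (sphere 0 1))" "finite_measure H"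
    "\<And>r B. r > 0 \<Longrightarrow> B \<in> sets H \<Longrightarrow>
       emeasure \<nu> (embed_plane ` {x. norm x > r \<and> x /\<^sub>R norm x \<in> B}) = ennreal (r powr (- 2)) * emeasure H B"
    using assms(6) by (auto simp: angular_measure_of_def)
  interpret finite_exponent_measure \<nu>
    using rv(2,3) by unfold_locales (auto simp: radon_measure_on_def)
  interpret H: finite_measure H by fact
  interpret polar_measure plane_measure H 2
  proof
    fix r :: real and B assume r: "r > 0" and B: "B \<in> sets H"
    have [measurable]: "B \<in> sets borel"
      using B by (auto simp: ang(1) sets_restrict_space_iff)
    have "{x. norm x > r \<and> x /\<^sub>R norm x \<in> B} \<in> sets borel" by measurable
    then show "emeasure plane_measure {x. norm x > r \<and> x /\<^sub>R norm x \<in> B}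
        = ennreal (r powr (- 2)) * emeasure H B"
      \<comment> \<open>Since r > 0, the polar set omits the origin, as the transfer to the plane
        requires.\<close>
      using r ang(3)[OF r B] by (subst emeasure_plane_measure) auto
  qed (use ang in \<open>auto simp: plane_measure_def\<close>)
  have b_nonneg: "b s \<ge> 0" if "s > 0" for s
    using assms(2) that by (auto simp: normalizing_function_def slowly_varying_def less_imp_le)
  obtain C where C: "\<And>t. t > 0 \<Longrightarrow> \<forall>\<^sub>F s in at_top.
      b s * measure M {\<omega> \<in> space M. norm (?X \<omega>) > s * t} \<le> C * t powr (- 2)"
    using V_set_tight_pair[OF assms(1,2) V] by blast
  have limit: "((\<lambda>s. b s * measure M {\<omega> \<in> space M. u (?X \<omega>) > s}) \<longlongrightarrow> radial_moment u) at_top"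
    if "continuous_on UNIV u" "\<And>t x. t > 0 \<Longrightarrow> u (t *\<^sub>R x) = t * u x" for u
    using assms(1) rv(1) b_nonneg vague_tendsto_plane_measure[OF rv(1) b_nonneg rv(4)] C that
    by (rule tail_limit_homogeneous)
  have meas: "(\<lambda>\<omega>. u (?X \<omega>)) \<in> borel_measurable M" if "continuous_on UNIV u" for u :: "real \<times> real \<Rightarrow> real"
    using that rv(1) measurable_compose borel_measurable_continuous_onI by blast
  \<comment> \<open>For x > 0, the events u > s x and u < -(s x) say that u/x and -u/x exceed s;
    both functions are again continuous and positively homogeneous.\<close>
  have V_linear: "(\<lambda>\<omega>. u (?X \<omega>)) \<in> V_set M b"
    if u: "continuous_on UNIV u" "\<And>t x. t > 0 \<Longrightarrow> u (t *\<^sub>R x) = t * u x" for u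
  proof -
    have "\<exists>l. ((\<lambda>s. b s * measure M {\<omega> \<in> space M. u (?X \<omega>) > s * x}) \<longlongrightarrow> l) at_top"
      if "x > 0" for x
    proof -
      have "continuous_on UNIV (\<lambda>z. u z / x)"
        using u(1) that by (intro continuous_intros) auto
      from limit[OF this] show ?thesis
        using u(2) that by (auto simp: pos_less_divide_eq)
    qed
    moreover have "\<exists>l. ((\<lambda>s. b s * measure M {\<omega> \<in> space M. u (?X \<omega>) < - (s * x)}) \<longlongrightarrow> l) at_top"
      if "x > 0" for x
    proof -
      have cont: "continuous_on UNIV (\<lambda>z. - u z / x)"
        using u(1) that by (intro continuous_intros) auto
      have "s < - u z / x \<longleftrightarrow> u z < - (s * x)" for s z
        using that by (auto simp: field_simps)
      with limit[OF cont] show ?thesis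
        using u(2) by auto
    qed
    ultimately show ?thesis using meas[OF u(1)] by (simp add: V_set_def)
  qed
  have norm_sq: "integrable H (\<lambda>w. (u w)\<^sup>2)"
    "(norm_b M b 2 (\<lambda>\<omega>. u (?X \<omega>)))\<^sup>2 = (\<integral>w. (u w)\<^sup>2 \<partial>H)"
    if u: "continuous_on UNIV u" "\<And>t x. t > 0 \<Longrightarrow> u (t *\<^sub>R x) = t * u x" for u
  proof -
    have abs: "continuous_on UNIV (\<lambda>z. \<bar>u z\<bar>)" "\<And>t x. t > 0 \<Longrightarrow> \<bar>u (t *\<^sub>R x)\<bar> = t * \<bar>u x\<bar>"
      using u by (auto intro!: continuous_intros simp: abs_mult)
    have sq: "max 0 \<bar>u w\<bar> powr 2 = (u w)\<^sup>2" for w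
      by (simp add: max_def)
    show "integrable H (\<lambda>w. (u w)\<^sup>2)"
      using integrable_radial[OF abs(1)] by (simp add: sq)
    have J: "radial_moment (\<lambda>z. \<bar>u z\<bar>) = (\<integral>w. (u w)\<^sup>2 \<partial>H)"
      by (simp add: radial_moment_def sq)
    \<comment> \<open>Applied to |u|, the limit theorem identifies the \<open>Lim\<close> in
      \<open>norm_b\<close>; squaring then undoes the root because the integral is
      nonnegative.\<close>
    have "norm_b M b 2 (\<lambda>\<omega>. u (?X \<omega>)) = (\<integral>w. (u w)\<^sup>2 \<partial>H) powr (1 / 2)"
      unfolding norm_b_def J[symmetric] using tendsto_Lim[OF _ limit[OF abs]] by simp
    then show "(norm_b M b 2 (\<lambda>\<omega>. u (?X \<omega>)))\<^sup>2 = (\<integral>w. (u w)\<^sup>2 \<partial>H)"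
      by (simp add: powr_half_sqrt)
  qed
  let ?p = "\<lambda>z::real \<times> real. fst z + snd z" and ?m = "\<lambda>z::real \<times> real. fst z - snd z"
  have lin: "continuous_on UNIV ?p" "\<And>t x. t > 0 \<Longrightarrow> ?p (t *\<^sub>R x) = t * ?p x"
    "continuous_on UNIV ?m" "\<And>t x. t > 0 \<Longrightarrow> ?m (t *\<^sub>R x) = t * ?m x"
    "continuous_on UNIV (fst :: real \<times> real \<Rightarrow> real)" "\<And>t x. t > 0 \<Longrightarrow> fst (t *\<^sub>R x :: real \<times> real) = t * fst x"
    "continuous_on UNIV (snd :: real \<times> real \<Rightarrow> real)" "\<And>t x. t > 0 \<Longrightarrow> snd (t *\<^sub>R x :: real \<times> real) = t * snd x"
    by (auto intro!: continuous_intros simp: algebra_simps)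
  note sq = norm_sq[OF lin(1,2)] norm_sq[OF lin(3,4)] norm_sq[OF lin(5,6)] norm_sq[OF lin(7,8)]
  have "(\<integral>w. (?p w)\<^sup>2 \<partial>H) + (\<integral>w. (?m w)\<^sup>2 \<partial>H) = (\<integral>w. (?p w)\<^sup>2 + (?m w)\<^sup>2 \<partial>H)"
    using sq(1,3) by simp
  also have "\<dots> = (\<integral>w. 2 * (fst w)\<^sup>2 + 2 * (snd w)\<^sup>2 \<partial>H)"
    by (simp add: power2_eq_square algebra_simps)
  also have "\<dots> = 2 * (\<integral>w. (fst w)\<^sup>2 \<partial>H) + 2 * (\<integral>w. (snd w)\<^sup>2 \<partial>H)"
    using sq(5,7) by simp
  finally show ?thesis
    using V_linear[OF lin(1,2)] V_linear[OF lin(3,4)] sq by simp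
qed

end
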